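(* Let $G$ be a finite abelian group, let $f : G \to \mathbb{C}$ have Wiener norm $\omega$, let $\xi \in (0,1)$, and let $0 < \delta \leqslant \omega$. Then there exist $\epsilon \in (0,1]$, a positive integer $d$, homomorphisms $\gamma_1,\dots,\gamma_d : G \to \mathcal{S}$, and a decomposition $f = g + h + k$ of functions $G \to \mathbb{C}$ such that: (i) $\|h\|_\infty \ll \delta$; (ii) $|\mathrm{supp}\, k| \leqslant \xi |G|$; (iii) $G$ is the disjoint union of the $\epsilon$-$d$-blocks $B_i$ (with respect to $\gamma_1,\dots,\gamma_d$), $g$ is constant on each $B_i$, and its value on each $B_i$ lies in $\delta\mathbb{Z}$; (iv) $\epsilon \gg \delta/\omega$ and $d \ll \frac{\omega^2}{\delta^2}\log\frac{1}{\xi}$.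
   Context: $\mathcal{S} = \{z\in\mathbb{C}: |z|=1\}$. For $f: G\to\mathbb{C}$, $\hat f(\gamma) = \sum_{x\in G} f(x)\overline{\gamma(x)}$ for characters $\gamma\in\hat G$, and the Wiener norm is $\|f\|_\omega = \frac{1}{|G|}\sum_{\gamma\in\hat G}|\hat f(\gamma)|$. Given $\epsilon\in(0,1]$, set $K = \lceil 1/\epsilon\rceil$ and split $\mathcal{S}$ into $K$ equal disjoint arcs $\mathcal{S}_1,\dots,\mathcal{S}_K$. Given homomorphisms $\gamma_1,\dots,\gamma_d: G\to\mathcal{S}$, an $\epsilon$-$d$-block is a set $\{g\in G : \gamma_1(g)\in\mathcal{S}_{i_1},\dots,\gamma_d(g)\in\mathcal{S}_{i_d}\}$ for some $1\leqslant i_1,\dots,i_d\leqslant K$. $X\ll Y$ means $X\leqslant cY$ for an absolute constant $c>0$.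
   Formalization: Values of g lie in δℤ for real-valued f, in δ(ℤ+iℤ) for complex f (f = i refutes δℤ); d is at most max(1, C(ω²/δ²)log(1/ξ)), as no positive d fits when ξ is near 1. Constants are uniform over groups on a fixed underlying type; the naturals cover all G up to isomorphism. *)

theory Defs
  imports Complex_Main "HOL-Library.FuncSet" "HOL-Library.Disjoint_Sets" "HOL-Algebra.Group"
begin

definition circle_group :: "complex monoid" where
  "circle_group = \<lparr>carrier = {z. cmod z = 1}, mult = (*), one = 1\<rparr>"

text \<open>Restricting to extensional functions makes each character of G occur exactly once
  (functions in \<^const>\<open>hom\<close> are unconstrained outside the carrier).\<close>

definition characters :: "('a, 'b) monoid_scheme \<Rightarrow> ('a \<Rightarrow> complex) set" where
  "characters G = hom G circle_group \<inter> extensional (carrier G)"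

definition fourier_coeff ::
    "('a, 'b) monoid_scheme \<Rightarrow> ('a \<Rightarrow> complex) \<Rightarrow> ('a \<Rightarrow> complex) \<Rightarrow> complex" where
  "fourier_coeff G f \<gamma> = (\<Sum>x\<in>carrier G. f x * cnj (\<gamma> x))"

definition wiener_norm :: "('a, 'b) monoid_scheme \<Rightarrow> ('a \<Rightarrow> complex) \<Rightarrow> real" where
  "wiener_norm G f =
     (\<Sum>\<gamma>\<in>characters G. cmod (fourier_coeff G f \<gamma>)) / real (card (carrier G))"

definition num_arcs :: "real \<Rightarrow> nat" where
  "num_arcs \<epsilon> = nat \<lceil>1 / \<epsilon>\<rceil>"

text \<open>Convention: the unit circle is cut, starting at the point 1 and going counterclockwise, into
  half-open arcs, numbered from 1 to K.\<close>

definition circle_arc :: "nat \<Rightarrow> nat \<Rightarrow> complex set" where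
  "circle_arc K j =
     cis ` {2 * pi * (real j - 1) / real K ..< 2 * pi * real j / real K}"

definition block_indices :: "real \<Rightarrow> nat \<Rightarrow> (nat \<Rightarrow> nat) set" where
  "block_indices \<epsilon> d = {1..d} \<rightarrow>\<^sub>E {1..num_arcs \<epsilon>}"

definition block ::
    "('a, 'b) monoid_scheme \<Rightarrow> real \<Rightarrow> nat \<Rightarrow> (nat \<Rightarrow> 'a \<Rightarrow> complex) \<Rightarrow> (nat \<Rightarrow> nat) \<Rightarrow> 'a set" where
  "block G \<epsilon> d \<gamma> i =
     {x \<in> carrier G. \<forall>j\<in>{1..d}. \<gamma> j x \<in> circle_arc (num_arcs \<epsilon>) (i j)}"

text \<open>
  Remarks on how the main statement is phrased.

  \<^item> The constants are chosen before the group, so at the instance \<open>'a = nat\<close> they are absolute: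
    every finite abelian group is isomorphic to one whose carrier is a set of natural numbers.

  \<^item> Multiples of \<open>\<delta>\<close> by (real) integers suffice only if f is real-valued: for f constantly
    \<open>\<i>\<close>, \<open>\<xi> = 1/2\<close> and \<open>\<delta>\<close> small, no g with values in \<open>\<delta>\<int>\<close> can be close to f anywhere. Hence the
    values of g lie in \<open>\<delta>\<int>\<close> if f is real-valued, and in \<open>\<delta>(\<int> + \<i>\<int>)\<close> in general.

  \<^item> For \<open>\<xi>\<close> close to 1 the quantity \<open>(\<omega>\<^sup>2 / \<delta>\<^sup>2) * ln (1 / \<xi>)\<close> can be arbitrarily small, whereas
    d is positive. Hence the maximum with 1 in the bound for d.
\<close>

end

theory Submission
  imports Defs "HOL-Algebra.Multiplicative_Group"
begin

text \<open>
  By Fourier inversion \<open>f / \<omega>\<close> is, pointwise, the mean of \<open>sgn (fourier_coeff G f \<chi>) \<chi>\<close> for a random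
  character \<open>\<chi>\<close> chosen with probability \<open>\<bar>fourier_coeff G f \<chi>\<bar> / (\<omega> \<bar>G\<bar>)\<close>. Averaging \<open>d\<close> independent samples, a Chernoff bound
  shows that some choice of characters gives an average \<open>F\<close> that is within \<open>O(\<delta>)\<close> of \<open>f\<close> outside a set of density \<open>\<xi>\<close>,
  if \<open>d\<close> is of order \<open>(\<omega> / \<delta>)\<^sup>2 ln (4 / \<xi>)\<close>; this is good enough unless \<open>\<xi>\<close> is close to 1.

  In that case put \<open>t = ln (1 / \<xi>)\<close>. With \<open>d\<close> of order \<open>(\<omega> / \<delta>)\<^sup>2 t\<close> samples the error \<open>f - F\<close> is
  \<open>O(\<delta> / sqrt t)\<close> on half of \<open>G\<close>. The disc of that radius meets \<open>O(1 / t)\<close> squares of side \<open>\<delta>\<close>, so by the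
  pigeonhole principle one of them contains \<open>f - F\<close> on a set of density at least \<open>t \<ge> 1 - \<xi>\<close>, and shifting
  \<open>F\<close> by the centre of this square gives the required approximation.

  Replacing each value of a character by the starting point of its arc costs another \<open>O(\<omega> \<epsilon>) = O(\<delta>)\<close> and
  makes the approximation constant on blocks; finally it is rounded to \<open>\<delta>(\<int> + \<i>\<int>)\<close>.
\<close>

section \<open>Arcs of the unit circle\<close>

text \<open>Arguments taken from arcs numbered 1 to \<open>K\<close> lie in the interval from 0 to 2
  pi, so two arguments of the same point agree. The starting angles of the two arcs then differ by
  less than one arc length, although they are multiples of it.\<close>

lemma circle_arc_disjoint:
  assumes "z \<in> circle_arc K i" "z \<in> circle_arc K j" "i \<in> {1..K}" "j \<in> {1..K}"
  shows "i = j"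
proof -
  define s where "s = (\<lambda>i::nat. 2 * pi * (real i - 1) / real K)"
  have K: "K > 0" using assms(3) by auto
  have bounds: "0 \<le> s i" "s i + 2 * pi / real K \<le> 2 * pi" if "i \<in> {1..K}" for i
  proof -
    have i: "1 \<le> real i" "real i \<le> real K" using that by auto
    show "0 \<le> s i" using i by (simp add: s_def)
    have "s i + 2 * pi / real K = 2 * pi * real i / real K"
      by (simp add: s_def diff_divide_distrib algebra_simps)
    also have "\<dots> \<le> 2 * pi" using i K by (simp add: field_simps)
    finally show "s i + 2 * pi / real K \<le> 2 * pi" .
  qed
  have mem: "\<exists>a. z = cis a \<and> s i \<le> a \<and> a < s i + 2 * pi / real K" if "z \<in> circle_arc K i" for i
  proof -
    have "2 * pi * real i / real K = s i + 2 * pi / real K"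
      by (simp add: s_def diff_divide_distrib algebra_simps)
    then show ?thesis using that by (auto simp: circle_arc_def s_def)
  qed
  obtain a b where a: "z = cis a" "s i \<le> a" "a < s i + 2 * pi / real K"
    and b: "z = cis b" "s j \<le> b" "b < s j + 2 * pi / real K"
    using mem[OF assms(1)] mem[OF assms(2)] by blast
  have "sin b = sin a \<and> cos b = cos a"
    using a(1) b(1) by (metis cis.sel)
  then obtain n :: int where n: "b = a + 2 * pi * n" using sin_cos_eq_iff by blast
  have "\<bar>b - a\<bar> < 2 * pi"
    using a b bounds[OF assms(3)] bounds[OF assms(4)] by linarith
  then have "2 * pi * \<bar>real_of_int n\<bar> < 2 * pi * 1"
    unfolding n by (simp add: abs_mult)
  then have "\<bar>real_of_int n\<bar> < 1"
    by (simp only: mult_less_cancel_left_pos[of "2*pi"] pi_gt_zero mult_pos_pos zero_less_numeral)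
  then have "a = b" using n by simp
  then have "\<bar>s i - s j\<bar> < 2 * pi / real K" using a b by linarith
  moreover have "s i - s j = (2 * pi / real K) * (real i - real j)"
    by (simp add: s_def diff_divide_distrib algebra_simps)
  ultimately have "(2 * pi / real K) * \<bar>real i - real j\<bar> < (2 * pi / real K) * 1"
    by (simp add: abs_mult)
  then have "\<bar>real i - real j\<bar> < 1"
    using K by (subst (asm) mult_less_cancel_left_pos) auto
  then show ?thesis by linarith
qed

lemma circle_arc_cover:
  assumes "cmod z = 1" "K > 0"
  shows "\<exists>j\<in>{1..K}. z \<in> circle_arc K j"
proof -
  obtain t where t: "0 \<le> t" "t < 2 * pi" "z = Complex (cos t) (sin t)"
    using complex_unimodular_polar[OF assms(1)] .
  define u where "u = real K * t / (2 * pi)"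
  have u: "0 \<le> u" "u < real K" using t assms(2) by (auto simp: u_def field_simps)
  have tu: "t = 2 * pi * u / real K" using assms(2) by (simp add: u_def)
  define m where "m = nat \<lfloor>u\<rfloor>"
  have m: "real m \<le> u" "u < real m + 1" using u(1) unfolding m_def by linarith+
  have "m < K" using m u by linarith
  \<comment> \<open>Arcs are numbered from 1, hence the successor.\<close>
  moreover have "z \<in> circle_arc K (Suc m)"
    unfolding circle_arc_def
  proof (rule image_eqI)
    show "z = cis t" using t(3) by (simp add: cis.code)
    show "t \<in> {2 * pi * (real (Suc m) - 1) / real K..<2 * pi * real (Suc m) / real K}"
      using m assms(2) by (auto simp: tu divide_simps)
  qed
  ultimately show ?thesis by (intro bexI[of _ "Suc m"]) auto
qed

definition arc_start :: "nat \<Rightarrow> nat \<Rightarrow> complex" where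
  "arc_start K j = cis (2 * pi * (real j - 1) / real K)"

text \<open>A chord is no longer than its arc: the chord has length
  \<open>2 * \<bar>sin ((a - b) / 2)\<bar>\<close>.\<close>

lemma cmod_cis_diff_le: "cmod (cis a - cis b) \<le> \<bar>a - b\<bar>"
proof -
  define t where "t = (a - b) / 2"
  have "(cmod (cis a - cis b))\<^sup>2 = (cos a - cos b)\<^sup>2 + (sin a - sin b)\<^sup>2"
    by (simp add: cmod_power2)
  also have "\<dots> = 2 - 2 * cos (a - b)"
    using sin_cos_squared_add[of a] sin_cos_squared_add[of b]
    by (simp add: cos_diff power2_eq_square algebra_simps)
  also have ab: "a - b = 2 * t" by (simp add: t_def)
  also have "2 - 2 * cos (2 * t) = (2 * sin t)\<^sup>2"
    by (simp add: cos_double_sin power_mult_distrib)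
  also have "\<dots> \<le> (2 * t)\<^sup>2"
    using abs_sin_x_le_abs_x[of t] by (simp add: abs_le_square_iff[symmetric] abs_mult)
  finally have "(cmod (cis a - cis b))\<^sup>2 \<le> \<bar>a - b\<bar>\<^sup>2"
    by (simp only: ab power2_abs)
  then show ?thesis by (rule power2_le_imp_le) simp
qed

lemma dist_arc_start:
  assumes "z \<in> circle_arc K j"
  shows "cmod (z - arc_start K j) \<le> 2 * pi / real K"
proof -
  from assms obtain a where a: "z = cis a" "2 * pi * (real j - 1) / real K \<le> a"
      "a < 2 * pi * real j / real K"
    by (auto simp: circle_arc_def)
  have "2 * pi * real j / real K - 2 * pi * (real j - 1) / real K = 2 * pi / real K"
    by (simp add: diff_divide_distrib algebra_simps)
  then have "\<bar>a - 2 * pi * (real j - 1) / real K\<bar> \<le> 2 * pi / real K"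
    using a by linarith
  then show ?thesis
    unfolding a(1) arc_start_def using cmod_cis_diff_le order_trans by blast
qed

text \<open>For \<open>z\<close> on the unit circle and \<open>K > 0\<close> exactly one
  \<open>j\<close> qualifies, by \<open>circle_arc_cover\<close> and
  \<open>circle_arc_disjoint\<close>. Applied to character values, it reads off the block of a group
  element.\<close>

definition arc_index :: "nat \<Rightarrow> complex \<Rightarrow> nat" where
  "arc_index K z = (SOME j. j \<in> {1..K} \<and> z \<in> circle_arc K j)"

lemma arc_index:
  assumes "cmod z = 1" "K > 0"
  shows "arc_index K z \<in> {1..K}" "z \<in> circle_arc K (arc_index K z)"
proof -
  have "arc_index K z \<in> {1..K} \<and> z \<in> circle_arc K (arc_index K z)"
    unfolding arc_index_def using circle_arc_cover[OF assms] unfolding Bex_def by (rule someI_ex)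
  then show "arc_index K z \<in> {1..K}" "z \<in> circle_arc K (arc_index K z)" by auto
qed

lemma arc_index_eqI:
  assumes "cmod z = 1" "j \<in> {1..K}" "z \<in> circle_arc K j"
  shows "arc_index K z = j"
  using assms arc_index[OF assms(1), of K] by (intro circle_arc_disjoint[of z K]) auto

section \<open>Sampling\<close>

lemma exp_le_quadratic:
  fixes y :: real
  assumes "\<bar>y\<bar> \<le> 1"
  shows "exp y \<le> 1 + y + y\<^sup>2"
proof (cases "y \<ge> 0")
  case True
  then show ?thesis using exp_bound assms by auto
next
  case False
  define u where "u = - y"
  have u: "u > 0" using False by (simp add: u_def)
  have "exp y = 1 / exp u" by (simp add: u_def exp_minus field_simps)
  also have "\<dots> \<le> 1 / (1 + u)"
    using u exp_ge_add_one_self[of u] by (intro divide_left_mono mult_pos_pos) auto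
  \<comment> \<open>The product of \<open>1 + u\<close> and \<open>1 - u + u\<^sup>2\<close> is 1
    plus the cube of \<open>u\<close>.\<close>
  also have "\<dots> \<le> 1 - u + u\<^sup>2"
    using u by (simp add: field_simps power2_eq_square)
  finally show ?thesis by (simp add: u_def)
qed

text \<open>First moment argument: if every value exceeded \<open>B\<close>, so would the mean.
  Strictness survives because weights with sum 1 cannot all vanish.\<close>

lemma exists_le_weighted_sum:
  fixes p \<phi> :: "'a \<Rightarrow> real"
  assumes "finite A" "\<And>a. a \<in> A \<Longrightarrow> p a \<ge> 0" "sum p A = 1" "(\<Sum>a\<in>A. p a * \<phi> a) \<le> B"
  shows "\<exists>a\<in>A. \<phi> a \<le> B"
proof (rule ccontr)
  assume "\<not> ?thesis"
  then have gt: "\<phi> a > B" if "a \<in> A" for a using that by force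
  have "\<exists>a\<in>A. p a > 0"
    using assms(2,3) by (metis less_eq_real_def sum.neutral zero_neq_one)
  then obtain a where "a \<in> A" "p a > 0" by auto
  then have "(\<Sum>a\<in>A. p a * B) < (\<Sum>a\<in>A. p a * \<phi> a)"
  proof (intro sum_strict_mono_ex1 ballI)
    show "p x * B \<le> p x * \<phi> x" if "x \<in> A" for x
      using that assms(2) gt by (simp add: mult_left_mono less_imp_le)
    show "\<exists>a\<in>A. p a * B < p a * \<phi> a"
      using \<open>a \<in> A\<close> \<open>p a > 0\<close> gt by (intro bexI[of _ a]) auto
  qed (use assms(1) in auto)
  then show False using assms(3,4) by (simp add: sum_distrib_right[symmetric])
qed

text \<open>Moment generating function of a centred bounded variable: \<open>l * w c\<close> has
  absolute value at most 1, so \<open>exp_le_quadratic\<close> applies, and its linear term vanishes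
  in the mean.\<close>

lemma weighted_exp_moment_le:
  fixes p :: "'c \<Rightarrow> real" and w :: "'c \<Rightarrow> real"
  assumes "finite C" "\<And>c. c \<in> C \<Longrightarrow> p c \<ge> 0" "sum p C = 1"
    and mean: "(\<Sum>c\<in>C. p c * w c) = 0" and w: "\<And>c. c \<in> C \<Longrightarrow> \<bar>w c\<bar> \<le> 2"
    and l: "0 \<le> l" "l \<le> 1 / 2"
  shows "(\<Sum>c\<in>C. p c * exp (l * w c)) \<le> exp (4 * l\<^sup>2)"
proof -
  have "p c * exp (l * w c) \<le> p c + l * (p c * w c) + p c * (4 * l\<^sup>2)" if "c \<in> C" for c
  proof -
    have "\<bar>l * w c\<bar> \<le> (1/2) * 2"
      unfolding abs_mult using l w[OF that] by (intro mult_mono) auto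
    then have "exp (l * w c) \<le> 1 + l * w c + (l * w c)\<^sup>2"
      by (intro exp_le_quadratic) simp
    also have "(l * w c)\<^sup>2 \<le> 4 * l\<^sup>2"
    proof -
      have "(w c)\<^sup>2 \<le> 2\<^sup>2" using w[OF that] by (metis abs_le_square_iff abs_numeral)
      then have "l\<^sup>2 * (w c)\<^sup>2 \<le> l\<^sup>2 * 4" by (intro mult_left_mono) auto
      then show ?thesis by (simp add: power_mult_distrib)
    qed
    finally have "exp (l * w c) \<le> 1 + l * w c + 4 * l\<^sup>2" by simp
    then have "p c * exp (l * w c) \<le> p c * (1 + l * w c + 4 * l\<^sup>2)"
      using assms(2)[OF that] by (rule mult_left_mono)
    then show ?thesis by (simp add: algebra_simps)
  qed
  then have "(\<Sum>c\<in>C. p c * exp (l * w c)) \<le> (\<Sum>c\<in>C. p c + l * (p c * w c) + p c * (4 * l\<^sup>2))"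
    by (rule sum_mono)
  also have "\<dots> = 1 + 4 * l\<^sup>2"
    by (simp add: sum.distrib assms(3) mean sum_distrib_left[symmetric] sum_distrib_right[symmetric])
  also have "\<dots> \<le> exp (4 * l\<^sup>2)" by (rule exp_ge_add_one_self)
  finally show ?thesis .
qed

text \<open>Chernoff's method for all points at once. The exponential moments \<open>\<Phi>\<close>,
  summed over points and four directions, have a small mean over random \<open>d\<close>-tuples;
  some tuple does no worse than the mean, and Markov's inequality over \<open>X\<close> bounds its
  bad points. The factor 4 counts directions; the factor 2 in \<open>2 * \<tau>\<close> pays for
  reducing a complex deviation to a real one.\<close>

lemma sampling:
  fixes p :: "'c \<Rightarrow> real" and v :: "'c \<Rightarrow> 'x \<Rightarrow> complex"
  assumes "finite C" "finite X" "\<And>c. c \<in> C \<Longrightarrow> p c \<ge> 0" "sum p C = 1"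
    and v: "\<And>c x. c \<in> C \<Longrightarrow> x \<in> X \<Longrightarrow> cmod (v c x) \<le> 1"
    and m: "\<And>x. x \<in> X \<Longrightarrow> m x = (\<Sum>c\<in>C. of_real (p c) * v c x)"
    and "d > 0" "\<tau> > 0"
  shows "\<exists>t\<in>{1..d} \<rightarrow> C. real (card {x\<in>X. cmod ((\<Sum>j=1..d. v (t j) x) / of_nat d - m x) > 2 * \<tau>})
     \<le> 4 * exp (- (real d * \<tau>\<^sup>2 / 16)) * real (card X)"
proof -
  \<comment> \<open>\<open>T\<close> with weights \<open>P\<close> is the space of \<open>d\<close>
    independent samples; extensionality makes each tuple occur once.\<close>
  define T where "T = {1..d} \<rightarrow>\<^sub>E C"
  \<comment> \<open>As \<open>u\<close> runs through \<open>U\<close>, \<open>Re (u * S)\<close>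
    takes the values of the real and imaginary part of \<open>S\<close> with both signs, so one of
    them is at least half of \<open>cmod S\<close>.\<close>
  define U where "U = {1, -1, \<i>, -\<i>}"
  define w where "w u x c = Re (u * (v c x - m x))" for u x c
  define P where "P t = (\<Prod>j\<in>{1..d}. p (t j))" for t
  define l where "l = \<tau> / 8" \<comment> \<open>minimises \<open>4 l\<^sup>2 - l \<tau>\<close>\<close>
  define \<Phi> where "\<Phi> t = (\<Sum>x\<in>X. \<Sum>u\<in>U. exp (l * (\<Sum>j=1..d. w u x (t j))))" for t
  have T: "finite T" unfolding T_def using assms(1) by (intro finite_PiE) auto
  have P0: "P t \<ge> 0" if "t \<in> T" for t
    unfolding P_def using that assms(3) by (intro prod_nonneg) (auto simp: T_def dest: PiE_mem)
  have P1: "sum P T = 1"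
    unfolding P_def T_def using assms(1,4)
    by (subst prod_sum_PiE[of "{1..d}" "\<lambda>_. C" "\<lambda>_. p", symmetric]) auto
  have mle: "cmod (m x) \<le> 1" if "x \<in> X" for x
  proof -
    have "cmod (m x) \<le> (\<Sum>c\<in>C. cmod (of_real (p c) * v c x))"
      unfolding m[OF that] by (rule norm_sum)
    also have "\<dots> \<le> (\<Sum>c\<in>C. p c)"
      using assms(3) v[OF _ that] by (intro sum_mono) (auto simp: norm_mult intro: mult_left_le)
    finally show ?thesis using assms(4) by simp
  qed
  have Y: "cmod (v c x - m x) \<le> 2" if "c \<in> C" "x \<in> X" for c x
    using norm_triangle_ineq4[of "v c x" "m x"] v[OF that] mle[OF that(2)] by simp
  have dev: "(\<Sum>j=1..d. v (t j) x) / of_nat d - m x = (\<Sum>j=1..d. v (t j) x - m x) / of_nat d" for t x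
    using assms(7) by (simp add: sum_subtractf diff_divide_distrib)
  show ?thesis
  proof (cases "\<tau> \<le> 4")
    case False
    \<comment> \<open>the parameter l is too large for the exponential moment bound, but all deviations are at most 2\<close>
    obtain t where t: "t \<in> T" using P1 by force
    have "cmod ((\<Sum>j=1..d. v (t j) x) / of_nat d - m x) \<le> 2 * \<tau>" if "x \<in> X" for x
    proof -
      have "cmod (\<Sum>j=1..d. v (t j) x - m x) \<le> (\<Sum>j=1..d. 2)"
        using t that Y by (intro sum_norm_le) (auto simp: T_def dest: PiE_mem)
      then have "cmod ((\<Sum>j=1..d. v (t j) x - m x) / of_nat d) \<le> 2"
        using assms(7) by (simp add: norm_divide field_simps)
      then show ?thesis using False by (simp only: dev)
    qed
    then have empty: "{x\<in>X. cmod ((\<Sum>j=1..d. v (t j) x) / of_nat d - m x) > 2 * \<tau>} = {}"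
      by force
    show ?thesis
    proof (rule bexI)
      show "t \<in> {1..d} \<rightarrow> C" using t by (auto simp: T_def)
    qed (subst empty, simp)
  next
    case True
    have "(\<Sum>t\<in>T. P t * \<Phi> t) =
        (\<Sum>x\<in>X. \<Sum>t\<in>T. \<Sum>u\<in>U. P t * exp (l * (\<Sum>j=1..d. w u x (t j))))"
      unfolding \<Phi>_def sum_distrib_left by (rule sum.swap)
    also have "\<dots> = (\<Sum>x\<in>X. \<Sum>u\<in>U. \<Sum>t\<in>T. P t * exp (l * (\<Sum>j=1..d. w u x (t j))))"
      by (intro sum.cong refl sum.swap)
    also have "\<dots> \<le> (\<Sum>x\<in>X. \<Sum>u\<in>U. exp (4 * l\<^sup>2) ^ d)"
    proof (intro sum_mono)
      fix x u assume x: "x \<in> X" and u: "u \<in> U"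
      have "(\<Sum>t\<in>T. P t * exp (l * (\<Sum>j=1..d. w u x (t j))))
          = (\<Sum>t\<in>T. \<Prod>j\<in>{1..d}. p (t j) * exp (l * w u x (t j)))"
        unfolding P_def by (simp add: sum_distrib_left exp_sum prod.distrib)
      \<comment> \<open>Independence: the sum over tuples of a product over coordinates factors into
        equal one-sample moments.\<close>
      also have "\<dots> = (\<Sum>c\<in>C. p c * exp (l * w u x c)) ^ d"
        unfolding T_def using assms(1)
        by (subst prod_sum_PiE[of "{1..d}" "\<lambda>_. C" "\<lambda>_ c. p c * exp (l * w u x c)", symmetric]) auto
      also have "\<dots> \<le> exp (4 * l\<^sup>2) ^ d"
      proof (intro power_mono weighted_exp_moment_le sum_nonneg mult_nonneg_nonneg)
        have "(\<Sum>c\<in>C. of_real (p c) * (v c x - m x)) = m x - of_real (sum p C) * m x"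
          unfolding m[OF x] by (simp add: algebra_simps sum_subtractf sum_distrib_right)
        then have "(\<Sum>c\<in>C. of_real (p c) * (v c x - m x)) = 0"
          using assms(4) by simp
        then have "Re (u * (\<Sum>c\<in>C. of_real (p c) * (v c x - m x))) = 0" by simp
        also have "u * (\<Sum>c\<in>C. of_real (p c) * (v c x - m x))
            = (\<Sum>c\<in>C. of_real (p c) * (u * (v c x - m x)))"
          by (simp add: sum_distrib_left mult_ac)
        finally show "(\<Sum>c\<in>C. p c * w u x c) = 0" by (simp add: w_def)
      next
        fix c assume c: "c \<in> C"
        have "cmod u = 1" using u by (auto simp: U_def)
        then have "cmod (u * (v c x - m x)) \<le> 2" using Y[OF c x] by (simp add: norm_mult)
        then show "\<bar>w u x c\<bar> \<le> 2" unfolding w_def using abs_Re_le_cmod order_trans by blast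
      qed (use assms True in \<open>auto simp: l_def\<close>)
      finally show "(\<Sum>t\<in>T. P t * exp (l * (\<Sum>j=1..d. w u x (t j)))) \<le> exp (4 * l\<^sup>2) ^ d" .
    qed
    also have "\<dots> \<le> 4 * exp (real d * (4 * l\<^sup>2)) * real (card X)"
    proof -
      have "card U \<le> 4" unfolding U_def by (simp add: card_insert_if)
      then have "real (card U) \<le> 4" by simp
      then show ?thesis by (simp add: exp_of_nat_mult mult_mono mult_ac)
    qed
    finally obtain t where t: "t \<in> T" and \<Phi>: "\<Phi> t \<le> 4 * exp (real d * (4 * l\<^sup>2)) * real (card X)"
      using exists_le_weighted_sum[OF T P0 P1] by blast
    define B where "B = {x\<in>X. cmod ((\<Sum>j=1..d. v (t j) x) / of_nat d - m x) > 2 * \<tau>}"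
    \<comment> \<open>Markov's inequality: every bad point contributes at least
      \<open>exp (l * (real d * \<tau>))\<close> to \<open>\<Phi> t\<close>.\<close>
    have "real (card B) * exp (l * (real d * \<tau>)) = (\<Sum>x\<in>B. exp (l * (real d * \<tau>)))" by simp
    also have "\<dots> \<le> (\<Sum>x\<in>B. \<Sum>u\<in>U. exp (l * (\<Sum>j=1..d. w u x (t j))))"
    proof (intro sum_mono)
      fix x assume "x \<in> B"
      define S where "S = (\<Sum>j=1..d. v (t j) x - m x)"
      have "2 * \<tau> < cmod (S / of_nat d)" using \<open>x \<in> B\<close> by (simp only: B_def dev S_def mem_Collect_eq)
      also have "\<dots> = cmod S / real d" by (simp add: norm_divide)
      finally have "2 * (real d * \<tau>) < cmod S" using assms(7) by (simp add: field_simps)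
      also have "\<dots> \<le> \<bar>Re S\<bar> + \<bar>Im S\<bar>" by (rule cmod_le)
      finally have "\<exists>u\<in>U. real d * \<tau> \<le> Re (u * S)" by (auto simp: U_def)
      then obtain u where u: "u \<in> U" "real d * \<tau> \<le> Re (u * S)" by auto
      have "(\<Sum>j=1..d. w u x (t j)) = Re (u * S)" by (simp add: w_def S_def sum_distrib_left)
      then have "exp (l * (real d * \<tau>)) \<le> exp (l * (\<Sum>j=1..d. w u x (t j)))"
        using u(2) assms(8) by (simp add: l_def mult_left_mono)
      also have "\<dots> \<le> (\<Sum>u\<in>U. exp (l * (\<Sum>j=1..d. w u x (t j))))"
        using u(1) by (intro member_le_sum) (auto simp: U_def)
      finally show "exp (l * (real d * \<tau>)) \<le> (\<Sum>u\<in>U. exp (l * (\<Sum>j=1..d. w u x (t j))))" .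
    qed
    also have "\<dots> \<le> \<Phi> t"
      unfolding \<Phi>_def using assms(2) by (intro sum_mono2) (auto simp: B_def intro!: sum_nonneg)
    also note \<Phi>
    finally have "real (card B) \<le>
        4 * exp (real d * (4 * l\<^sup>2)) * real (card X) / exp (l * (real d * \<tau>))"
      by (simp add: pos_le_divide_eq)
    also have "\<dots> = 4 * exp (real d * (4 * l\<^sup>2) - l * (real d * \<tau>)) * real (card X)"
      by (simp add: exp_diff)
    also have "real d * (4 * l\<^sup>2) - l * (real d * \<tau>) = - (real d * \<tau>\<^sup>2 / 16)"
      by (simp add: l_def power2_eq_square)
    finally show ?thesis using t by (intro bexI[of _ t]) (auto simp: B_def T_def)
  qed
qed

section \<open>Characters of finite abelian groups\<close>

lemma mem_characters:
  "\<chi> \<in> characters G \<longleftrightarrow>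
     (\<forall>x\<in>carrier G. cmod (\<chi> x) = 1) \<and>
     (\<forall>x\<in>carrier G. \<forall>y\<in>carrier G. \<chi> (x \<otimes>\<^bsub>G\<^esub> y) = \<chi> x * \<chi> y) \<and>
     \<chi> \<in> extensional (carrier G)"
  by (auto simp: characters_def hom_def circle_group_def Pi_iff)

locale finite_comm_group = comm_group G for G (structure) +
  assumes fin: "finite (carrier G)"
begin

lemma order_pos: "order G > 0"
  using fin by (auto simp: order_def card_gt_0_iff)

section \<open>Extending characters from subgroups\<close>

definition partial_character :: "'a set \<Rightarrow> ('a \<Rightarrow> complex) \<Rightarrow> bool" where
  "partial_character H \<chi> \<longleftrightarrow> subgroup H G \<and> \<chi> \<one> = 1 \<and>
     (\<forall>x\<in>H. \<forall>y\<in>H. \<chi> (x \<otimes> y) = \<chi> x * \<chi> y)"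

lemma partial_character_pow:
  assumes "partial_character H \<chi>" "x \<in> H"
  shows "\<chi> (x [^] (n::nat)) = \<chi> x ^ n"
proof (induction n)
  case 0
  then show ?case using assms by (simp add: partial_character_def)
next
  case (Suc n)
  interpret subgroup H G using assms by (simp add: partial_character_def)
  have "x [^] n \<in> H" using assms(2)
    by (induction n) auto
  then show ?case using assms Suc by (simp add: partial_character_def)
qed

text \<open>Modulus 1 is a consequence of finiteness: the values are roots of unity, because
  \<open>x\<close> has exponent \<open>order G\<close> and \<open>\<chi> \<one> = 1\<close>.\<close>

lemma partial_character_norm:
  assumes "partial_character H \<chi>" "x \<in> H"
  shows "cmod (\<chi> x) = 1"
proof -
  have "x \<in> carrier G" using assms by (meson partial_character_def subgroup.mem_carrier)
  then have "\<chi> x ^ order G = 1"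
    using partial_character_pow[OF assms, of "order G"] assms(1)
    by (simp add: pow_order_eq_1 partial_character_def)
  then have "cmod (\<chi> x) ^ order G = 1" by (metis norm_one norm_power)
  then show ?thesis
    using order_pos power_eq_1_iff[of "cmod (\<chi> x)" "order G"] by auto
qed

text \<open>This is the order of the coset of \<open>a\<close> in the quotient of \<open>G\<close>
  by \<open>H\<close>.\<close>

definition relative_order :: "'a set \<Rightarrow> 'a \<Rightarrow> nat" where
  "relative_order H a = (LEAST n. n > 0 \<and> a [^] n \<in> H)"

text \<open>Some positive exponent qualifies since \<open>a [^] order G = \<one>\<close>.
  Divisibility is division with remainder: the power of \<open>a\<close> to the remainder lies in
  \<open>H\<close>, so minimality makes the remainder 0.\<close>

lemma relative_order:
  assumes "subgroup H G" "a \<in> carrier G"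
  shows "relative_order H a > 0" "a [^] relative_order H a \<in> H"
    "\<And>m::nat. a [^] m \<in> H \<Longrightarrow> relative_order H a dvd m"
proof -
  interpret subgroup H G by fact
  define n where "n = relative_order H a"
  have "order G > 0 \<and> a [^] order G \<in> H"
    using assms order_pos by (simp add: pow_order_eq_1)
  then have n: "n > 0 \<and> a [^] n \<in> H"
    unfolding n_def relative_order_def by (rule LeastI)
  then show "relative_order H a > 0" "a [^] relative_order H a \<in> H" by (auto simp: n_def)
  fix m :: nat assume m: "a [^] m \<in> H"
  have "a [^] (m div n * n) = (a [^] n) [^] (m div n)"
    using assms(2) by (simp add: nat_pow_pow mult.commute)
  also have "\<dots> \<in> H"
  proof -
    have "x [^] (k::nat) \<in> H" if "x \<in> H" for x k using that by (induction k) auto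
    then show ?thesis using n by blast
  qed
  finally have q: "a [^] (m div n * n) \<in> H" .
  have "a [^] m = a [^] (m div n * n) \<otimes> a [^] (m mod n)"
    using assms(2) by (simp add: nat_pow_mult)
  then have "a [^] (m mod n) = inv (a [^] (m div n * n)) \<otimes> a [^] m"
    using assms(2) by (simp add: m_assoc[symmetric])
  then have "a [^] (m mod n) \<in> H" using q m by simp
  moreover have "m mod n < n" using n by simp
  moreover have "\<not> (m mod n > 0 \<and> a [^] (m mod n) \<in> H)"
    by (rule not_less_Least) (use \<open>m mod n < n\<close> in \<open>simp only: n_def relative_order_def\<close>)
  ultimately have "m mod n = 0" by simp
  then show "relative_order H a dvd m" unfolding n_def by (simp add: mod_eq_0_iff_dvd)
qed

text \<open>The subgroup generated by \<open>H\<close> and \<open>a\<close> consists of the products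
  \<open>h \<otimes> a [^] k\<close>, and the extension must send such a product to
  \<open>\<chi> h * z ^ k\<close>. Two representations of one element differ by a power of
  \<open>a\<close> inside \<open>H\<close>, whose exponent is a multiple of the relative order; the
  condition on \<open>z\<close> makes both values agree.\<close>

lemma extend_partial_character:
  assumes \<chi>: "partial_character H \<chi>" and a: "a \<in> carrier G"
    and z: "z ^ relative_order H a = \<chi> (a [^] relative_order H a)"
  shows "\<exists>H' \<chi>'. partial_character H' \<chi>' \<and> H \<subseteq> H' \<and> a \<in> H' \<and> \<chi>' a = z \<and> (\<forall>h\<in>H. \<chi>' h = \<chi> h)"
proof -
  have sub: "subgroup H G" using \<chi> by (simp add: partial_character_def)
  interpret subgroup H G by fact
  define n where "n = relative_order H a"
  note ro = relative_order[OF sub a, folded n_def]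
  define H' where "H' = {h \<otimes> a [^] k | h k::nat. h \<in> H}"
  define \<chi>' where "\<chi>' x = (THE y. \<exists>h\<in>H. \<exists>k::nat. x = h \<otimes> a [^] k \<and> y = \<chi> h * z ^ k)" for x
  have mult: "\<chi> (x \<otimes> y) = \<chi> x * \<chi> y" if "x \<in> H" "y \<in> H" for x y
    using \<chi> that by (simp add: partial_character_def)
  have one: "\<chi> \<one> = 1" using \<chi> by (simp add: partial_character_def)
  have wd_le: "\<chi> h * z ^ k = \<chi> h' * z ^ l"
    if h: "h \<in> H" "h' \<in> H" "h \<otimes> a [^] k = h' \<otimes> a [^] l" and "k \<le> l" for h h' and k l :: nat
  proof -
    have "a [^] l = a [^] (l - k) \<otimes> a [^] k"
      using a \<open>k \<le> l\<close> by (simp add: nat_pow_mult)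
    then have "h \<otimes> a [^] k = (h' \<otimes> a [^] (l - k)) \<otimes> a [^] k"
      using h a by (simp add: m_assoc)
    then have eq: "h = h' \<otimes> a [^] (l - k)" using h a by simp
    then have "a [^] (l - k) = inv h' \<otimes> h" using h a by (simp add: m_assoc[symmetric])
    then have mem: "a [^] (l - k) \<in> H" using h by simp
    then obtain q where q: "l - k = n * q" using ro(3) by (metis dvdE)
    have "\<chi> (a [^] (l - k)) = \<chi> ((a [^] n) [^] q)" using a by (simp add: q nat_pow_pow)
    also have "\<dots> = z ^ (l - k)"
      using partial_character_pow[OF \<chi> ro(2)] z by (simp add: q n_def power_mult)
    finally have "\<chi> h = \<chi> h' * z ^ (l - k)" using mult[OF h(2) mem] eq by simp
    then have "\<chi> h * z ^ k = \<chi> h' * (z ^ (l - k) * z ^ k)" by simp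
    also have "z ^ (l - k) * z ^ k = z ^ l" using \<open>k \<le> l\<close> by (simp add: power_add[symmetric])
    finally show ?thesis .
  qed
  have wd: "\<chi> h * z ^ k = \<chi> h' * z ^ l"
    if "h \<in> H" "h' \<in> H" "h \<otimes> a [^] k = h' \<otimes> a [^] l" for h h' and k l :: nat
    using wd_le[of h h' k l] wd_le[of h' h l k] that by (metis nat_le_linear)
  have val: "\<chi>' (h \<otimes> a [^] k) = \<chi> h * z ^ k" if "h \<in> H" for h and k :: nat
    unfolding \<chi>'_def
  proof (rule the_equality)
    show "\<exists>h'\<in>H. \<exists>l::nat. h \<otimes> a [^] k = h' \<otimes> a [^] l \<and> \<chi> h * z ^ k = \<chi> h' * z ^ l"
      using that by (intro bexI[of _ h] exI[of _ k]) auto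
  qed (use wd that in metis)
  have prod: "(h \<otimes> a [^] k) \<otimes> (h' \<otimes> a [^] l) = (h \<otimes> h') \<otimes> a [^] (k + l)"
    if "h \<in> H" "h' \<in> H" for h h' and k l :: nat
    using that a by (simp add: nat_pow_mult[symmetric] m_ac)
  have mem: "\<exists>h k. x = h \<otimes> a [^] (k::nat) \<and> h \<in> H" if "x \<in> H'" for x
    using that by (auto simp: H'_def)
  have H'_carrier: "H' \<subseteq> carrier G" using a by (auto simp: H'_def)
  have H'_closed: "x \<otimes> y \<in> H'" if "x \<in> H'" "y \<in> H'" for x y
    using mem[OF that(1)] mem[OF that(2)] prod unfolding H'_def by fastforce
  have one_H': "\<one> \<in> H'" unfolding H'_def
    using one_closed by (force intro!: exI[of _ \<one>] exI[of _ 0])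
  have sub': "subgroup H' G"
  proof
    fix x assume x: "x \<in> H'"
    then have xG: "x \<in> carrier G" using H'_carrier by auto
    have pow: "x [^] (k::nat) \<in> H'" for k
      by (induction k) (use x H'_closed one_H' in auto)
    \<comment> \<open>In a finite group the inverse is a natural power, so closure under products
      gives closure under inverses.\<close>
    have "x [^] (order G - 1) \<otimes> x = \<one>"
      using pow_order_eq_1[OF xG] order_pos nat_pow_Suc[of x "order G - 1"] by simp
    then have "inv x = x [^] (order G - 1)" using xG by (simp add: inv_equality)
    then show "inv x \<in> H'" using pow by simp
  qed (use H'_carrier H'_closed one_H' in auto)
  have restr: "\<chi>' h = \<chi> h" if "h \<in> H" for h
    using val[OF that, of 0] that by simp
  have "partial_character H' \<chi>'"
    unfolding partial_character_def
  proof (intro conjI ballI sub')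
    show "\<chi>' \<one> = 1" using restr[OF one_closed] one by simp
    fix x y assume "x \<in> H'" "y \<in> H'"
    then show "\<chi>' (x \<otimes> y) = \<chi>' x * \<chi>' y"
      using mem[of x] mem[of y]
      by (auto simp: prod val mult power_add)
  qed
  moreover have "H \<subseteq> H'"
  proof
    fix h assume "h \<in> H"
    then have "h = h \<otimes> a [^] (0::nat)" by simp
    then show "h \<in> H'" using \<open>h \<in> H\<close> unfolding H'_def by blast
  qed
  moreover have "a \<in> H'" "\<chi>' a = z"
  proof -
    have "a = \<one> \<otimes> a [^] (1::nat)" using a by simp
    then show "a \<in> H'" unfolding H'_def using one_closed by blast
    show "\<chi>' a = z" using val[OF one_closed, of 1] a one by simp
  qed
  ultimately show ?thesis using restr by blast
qed

text \<open>Induction on the number of elements outside \<open>H\<close>: adjoin a missing element,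
  whose value may be any root, of degree its relative order, of a value already fixed.\<close>

lemma extend_to_character:
  assumes "partial_character H \<chi>"
  shows "\<exists>\<chi>'. \<chi>' \<in> characters G \<and> (\<forall>h\<in>H. \<chi>' h = \<chi> h)"
  using assms
proof (induction "card (carrier G - H)" arbitrary: H \<chi> rule: less_induct)
  case less
  have sub: "subgroup H G" using less.prems by (simp add: partial_character_def)
  show ?case
  proof (cases "carrier G \<subseteq> H")
    case True
    then have H: "H = carrier G" using sub subgroup.subset by blast
    have "restrict \<chi> (carrier G) \<in> characters G"
      using less.prems partial_character_norm[OF less.prems] unfolding H
      by (auto simp: mem_characters partial_character_def)
    then show ?thesis by (intro exI[of _ "restrict \<chi> (carrier G)"]) (auto simp: H)
  next
    case False
    then obtain a where a: "a \<in> carrier G" "a \<notin> H" by auto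
    define n where "n = relative_order H a"
    note ro = relative_order[OF sub a(1), folded n_def]
    define w where "w = \<chi> (a [^] n)"
    have "cmod w = 1" unfolding w_def using partial_character_norm[OF less.prems ro(2)] .
    then have "w \<noteq> 0" by auto
    then have "w = cis (Arg w)" using cis_Arg[of w] \<open>cmod w = 1\<close> by (metis sgn_eq of_real_1 div_by_1)
    \<comment> \<open>Dividing the argument by \<open>n\<close> produces the required root.\<close>
    also have "\<dots> = cis (Arg w / n) ^ n" using ro(1) by (simp add: DeMoivre)
    finally have "cis (Arg w / n) ^ relative_order H a = \<chi> (a [^] relative_order H a)"
      by (simp add: w_def n_def)
    from extend_partial_character[OF less.prems a(1) this] obtain H' \<chi>' where
      H': "partial_character H' \<chi>'" "H \<subseteq> H'" "a \<in> H'" "\<forall>h\<in>H. \<chi>' h = \<chi> h" by blast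
    have "card (carrier G - H') < card (carrier G - H)"
      using a H' fin by (intro psubset_card_mono) auto
    from less.hyps[OF this H'(1)] show ?thesis using H' by (metis subsetD)
  qed
qed

text \<open>Over the trivial subgroup the relative order \<open>n\<close> of \<open>x\<close> is its
  usual order, which exceeds 1. So \<open>x\<close> may be sent to the primitive root of unity
  \<open>cis (2 * pi / n)\<close>, and this extends to \<open>G\<close>.\<close>

lemma separating_character:
  assumes "x \<in> carrier G" "x \<noteq> \<one>"
  shows "\<exists>\<chi>\<in>characters G. \<chi> x \<noteq> 1"
proof -
  have triv: "partial_character {\<one>} (\<lambda>_. 1)"
    by (simp add: partial_character_def triv_subgroup)
  define n where "n = relative_order {\<one>} x"
  note ro = relative_order[OF triv_subgroup assms(1), folded n_def]
  have "n \<noteq> 1" using ro(2) assms by auto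
  then have n: "n > 1" using ro(1) by linarith
  define z where "z = cis (2 * pi / n)"
  have "z ^ n = 1" using n by (simp add: z_def DeMoivre)
  have "z \<noteq> 1"
  proof
    assume "z = 1"
    then have "sin (2 * pi / n) = sin 0 \<and> cos (2 * pi / n) = cos 0"
      by (simp add: z_def complex_eq_iff)
    then obtain m :: int where "2 * pi / n = 0 + 2 * pi * m"
      using sin_cos_eq_iff by blast
    then have "real_of_int m * real n = 1" using n by (simp add: field_simps)
    then have "m * int n = 1" by (metis of_int_eq_1_iff of_int_mult of_int_of_nat_eq)
    then show False using n by (simp add: zmult_eq_1_iff)
  qed
  obtain H' \<chi>' where "partial_character H' \<chi>'" "x \<in> H'" "\<chi>' x = z"
    using extend_partial_character[OF triv assms(1), of z] \<open>z ^ n = 1\<close> by (auto simp: n_def)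
  then show ?thesis using extend_to_character[of H' \<chi>'] \<open>z \<noteq> 1\<close> by metis
qed

section \<open>Orthogonality of characters and Fourier inversion\<close>

lemma character_one: "\<chi> \<in> characters G \<Longrightarrow> \<chi> \<one> = 1"
proof -
  assume \<chi>: "\<chi> \<in> characters G"
  then have "\<chi> \<one> * \<chi> \<one> = \<chi> \<one>" "\<chi> \<one> \<noteq> 0"
    unfolding mem_characters by (metis one_closed l_one, metis one_closed norm_zero zero_neq_one)
  then show ?thesis by simp
qed

lemma character_pow: "\<chi> \<in> characters G \<Longrightarrow> x \<in> carrier G \<Longrightarrow> \<chi> (x [^] (n::nat)) = \<chi> x ^ n"
  by (induction n) (auto simp: character_one mem_characters)

lemma finite_characters: "finite (characters G)"
proof -
  have "characters G \<subseteq> carrier G \<rightarrow>\<^sub>E {z. z ^ order G = 1}"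
  proof
    fix \<chi> assume \<chi>: "\<chi> \<in> characters G"
    then have "\<chi> x ^ order G = 1" if "x \<in> carrier G" for x
      using character_pow[OF \<chi> that, of "order G"] that by (simp add: pow_order_eq_1 character_one)
    then show "\<chi> \<in> carrier G \<rightarrow>\<^sub>E {z. z ^ order G = 1}"
      using \<chi> by (auto simp: mem_characters PiE_iff)
  qed
  moreover have "finite {z::complex. z ^ order G = 1}"
    using finite_roots_unity[of "order G"] order_pos by simp
  ultimately show ?thesis using fin by (metis finite_PiE finite_subset)
qed

text \<open>Translating the summation variable by \<open>a\<close> multiplies the sum by
  \<open>\<chi> a\<close>, so the sum vanishes as soon as some \<open>\<chi> a\<close> differs from
  1.\<close>

lemma sum_character:
  assumes "\<chi> \<in> characters G"
  shows "(\<Sum>x\<in>carrier G. \<chi> x) = (if \<forall>x\<in>carrier G. \<chi> x = 1 then of_nat (order G) else 0)"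
proof (cases "\<forall>x\<in>carrier G. \<chi> x = 1")
  case True
  then show ?thesis by (simp add: order_def)
next
  case False
  then obtain a where a: "a \<in> carrier G" "\<chi> a \<noteq> 1" by auto
  have bij: "bij_betw (\<lambda>x. a \<otimes> x) (carrier G) (carrier G)"
    using a(1) by (intro bij_betw_byWitness[where f' = "\<lambda>x. inv a \<otimes> x"])
      (auto simp: m_assoc[symmetric])
  have "(\<Sum>x\<in>carrier G. \<chi> x) = (\<Sum>x\<in>carrier G. \<chi> (a \<otimes> x))"
    by (rule sum.reindex_bij_betw[OF bij, symmetric])
  also have "\<dots> = \<chi> a * (\<Sum>x\<in>carrier G. \<chi> x)"
    using assms a(1) by (simp add: mem_characters sum_distrib_left)
  finally show ?thesis using a(2) False by auto
qed

lemma character_mult_closed: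
  assumes "\<chi> \<in> characters G" "\<psi> \<in> characters G"
  shows "restrict (\<lambda>x. \<chi> x * \<psi> x) (carrier G) \<in> characters G"
  using assms by (auto simp: mem_characters norm_mult)

text \<open>Dual to \<open>sum_character\<close>: multiplication by a character that separates
  \<open>x\<close> from \<open>\<one>\<close> permutes the characters and multiplies the sum by a
  factor other than 1.\<close>

lemma sum_over_characters_eq_0:
  assumes "x \<in> carrier G" "x \<noteq> \<one>"
  shows "(\<Sum>\<chi>\<in>characters G. \<chi> x) = 0"
proof -
  obtain \<psi> where \<psi>: "\<psi> \<in> characters G" "\<psi> x \<noteq> 1" using separating_character[OF assms] by auto
  define m where "m \<chi> = restrict (\<lambda>x. \<psi> x * \<chi> x) (carrier G)" for \<chi> :: "'a \<Rightarrow> complex"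
  have inj: "inj_on m (characters G)"
  proof (rule inj_onI)
    fix \<chi> \<chi>' assume \<chi>: "\<chi> \<in> characters G" "\<chi>' \<in> characters G" "m \<chi> = m \<chi>'"
    show "\<chi> = \<chi>'"
    proof (rule extensionalityI[of _ "carrier G"])
      fix y assume y: "y \<in> carrier G"
      have "\<psi> y \<noteq> 0" using \<psi>(1) y by (auto simp: mem_characters)
      moreover have "\<psi> y * \<chi> y = \<psi> y * \<chi>' y"
        using fun_cong[OF \<chi>(3), of y] y by (simp add: m_def)
      ultimately show "\<chi> y = \<chi>' y" by simp
    qed (use \<chi> in \<open>auto simp: mem_characters\<close>)
  qed
  have "m ` characters G \<subseteq> characters G"
    using character_mult_closed \<psi>(1) by (auto simp: m_def)
  \<comment> \<open>An injective self-map of a finite set is bijective, which avoids constructing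
    inverse characters.\<close>
  then have bij: "bij_betw m (characters G) (characters G)"
    using inj finite_characters by (simp add: bij_betw_def endo_inj_surj)
  have "(\<Sum>\<chi>\<in>characters G. \<chi> x) = (\<Sum>\<chi>\<in>characters G. m \<chi> x)"
    by (rule sum.reindex_bij_betw[OF bij, symmetric])
  also have "\<dots> = \<psi> x * (\<Sum>\<chi>\<in>characters G. \<chi> x)"
    using assms(1) by (simp add: m_def sum_distrib_left)
  finally show ?thesis using \<psi>(2) by simp
qed

text \<open>Double counting of the sum of \<open>\<chi> x\<close> over all pairs: only
  \<open>x = \<one>\<close> contributes in one order of summation, only the trivial character
  \<open>e\<close> in the other.\<close>

lemma card_characters: "card (characters G) = order G"
proof -
  define e where "e = restrict (\<lambda>_. 1::complex) (carrier G)"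
  have e: "e \<in> characters G" by (simp add: e_def mem_characters)
  have triv: "(\<forall>x\<in>carrier G. \<chi> x = 1) \<longleftrightarrow> \<chi> = e" if "\<chi> \<in> characters G" for \<chi>
    using that by (auto simp: e_def mem_characters intro: extensionalityI[of _ "carrier G"])
  have "(\<Sum>x\<in>carrier G. \<Sum>\<chi>\<in>characters G. \<chi> x)
      = (\<Sum>x\<in>carrier G. if x = \<one> then of_nat (card (characters G)) else 0)"
    by (intro sum.cong refl) (simp add: sum_over_characters_eq_0 character_one)
  also have "\<dots> = of_nat (card (characters G))" using fin by simp
  finally have 1: "(\<Sum>x\<in>carrier G. \<Sum>\<chi>\<in>characters G. \<chi> x) = of_nat (card (characters G))" .
  have "(\<Sum>\<chi>\<in>characters G. \<Sum>x\<in>carrier G. \<chi> x)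
      = (\<Sum>\<chi>\<in>characters G. if \<chi> = e then of_nat (order G) else 0)"
    by (intro sum.cong refl) (simp add: sum_character triv)
  also have "\<dots> = of_nat (order G)" using finite_characters e by simp
  finally have "(of_nat (card (characters G)) :: complex) = of_nat (order G)"
    using 1 sum.swap[of "\<lambda>x \<chi>. \<chi> x" "characters G" "carrier G"] by metis
  then show ?thesis by (simp only: of_nat_eq_iff)
qed

text \<open>After exchanging the sums, orthogonality over the characters (\<open>kernel\<close>)
  leaves only the term with \<open>y = x\<close>.\<close>

lemma fourier_inversion:
  assumes x: "x \<in> carrier G"
  shows "f x = (\<Sum>\<chi>\<in>characters G. fourier_coeff G f \<chi> * \<chi> x) / of_nat (order G)"
proof -
  have kernel: "(\<Sum>\<chi>\<in>characters G. cnj (\<chi> y) * \<chi> x) = (if y = x then of_nat (order G) else 0)"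
    if y: "y \<in> carrier G" for y
  proof -
    have "cnj (\<chi> y) * \<chi> x = \<chi> (inv y \<otimes> x)" if \<chi>: "\<chi> \<in> characters G" for \<chi>
    proof -
      have "\<chi> (y \<otimes> (inv y \<otimes> x)) = \<chi> y * \<chi> (inv y \<otimes> x)"
        using \<chi> x y by (simp add: mem_characters)
      then have "\<chi> x = \<chi> y * \<chi> (inv y \<otimes> x)" using x y by (simp add: m_assoc[symmetric])
      moreover have "cnj (\<chi> y) * \<chi> y = 1"
        using \<chi> y by (simp add: mem_characters complex_norm_square[symmetric] mult.commute)
      ultimately show ?thesis by (simp add: mult.assoc[symmetric])
    qed
    then have "(\<Sum>\<chi>\<in>characters G. cnj (\<chi> y) * \<chi> x) = (\<Sum>\<chi>\<in>characters G. \<chi> (inv y \<otimes> x))"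
      by simp
    also have "\<dots> = (if y = x then of_nat (order G) else 0)"
    proof (cases "y = x")
      case True
      then show ?thesis using x by (simp add: character_one card_characters)
    next
      case False
      have "inv y \<otimes> x \<noteq> \<one>"
        using False x y by (metis inv_closed inv_equality inv_inv)
      then show ?thesis using False x y by (simp add: sum_over_characters_eq_0)
    qed
    finally show ?thesis .
  qed
  have "(\<Sum>\<chi>\<in>characters G. fourier_coeff G f \<chi> * \<chi> x)
      = (\<Sum>y\<in>carrier G. f y * (\<Sum>\<chi>\<in>characters G. cnj (\<chi> y) * \<chi> x))"
    unfolding fourier_coeff_def sum_distrib_right sum_distrib_left
    by (subst sum.swap) (simp add: mult.assoc)
  also have "\<dots> = (\<Sum>y\<in>carrier G. if y = x then f x * of_nat (order G) else 0)"
    by (intro sum.cong refl) (simp add: kernel)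
  also have "\<dots> = f x * of_nat (order G)" using fin x by simp
  finally show ?thesis using order_pos by simp
qed

end

section \<open>Rounding on blocks\<close>

text \<open>Each coordinate moves by at most half of \<open>\<delta>\<close>, and the modulus is at
  most the sum of the two.\<close>

lemma cmod_diff_round_le:
  fixes z :: complex and \<delta> :: real
  assumes "\<delta> > 0"
  shows "cmod (z - of_real \<delta> * (of_int (round (Re z / \<delta>)) + \<i> * of_int (round (Im z / \<delta>)))) \<le> \<delta>"
    (is "cmod (z - ?r) \<le> \<delta>")
proof -
  have part: "\<bar>u - \<delta> * of_int (round (u / \<delta>))\<bar> \<le> \<delta> / 2" for u
  proof -
    have "\<bar>\<delta> * (of_int (round (u / \<delta>)) - u / \<delta>)\<bar> \<le> \<delta> * (1 / 2)"
      unfolding abs_mult using assms of_int_round_abs_le[of "u / \<delta>"] by (intro mult_mono) auto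
    also have "\<delta> * (of_int (round (u / \<delta>)) - u / \<delta>) = - (u - \<delta> * of_int (round (u / \<delta>)))"
      using assms by (simp add: algebra_simps)
    finally show ?thesis by (simp only: abs_minus_cancel mult_1_right times_divide_eq_right)
  qed
  have "cmod (z - ?r) \<le> \<bar>Re (z - ?r)\<bar> + \<bar>Im (z - ?r)\<bar>" by (rule cmod_le)
  also have "\<dots> \<le> \<delta>" using part[of "Re z"] part[of "Im z"] by simp
  finally show ?thesis .
qed

context finite_comm_group
begin

lemma blocks_partition:
  assumes "\<And>j. j \<in> {1..d} \<Longrightarrow> \<gamma> j \<in> characters G" "num_arcs \<epsilon> > 0"
  shows "disjoint_family_on (block G \<epsilon> d \<gamma>) (block_indices \<epsilon> d)"
    and "(\<Union>i\<in>block_indices \<epsilon> d. block G \<epsilon> d \<gamma> i) = carrier G"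
proof -
  define K where "K = num_arcs \<epsilon>"
  have norm: "cmod (\<gamma> j x) = 1" if "j \<in> {1..d}" "x \<in> carrier G" for j x
    using assms(1)[OF that(1)] that(2) by (simp add: mem_characters)
  show "disjoint_family_on (block G \<epsilon> d \<gamma>) (block_indices \<epsilon> d)"
    unfolding disjoint_family_on_def
  proof (intro ballI impI equals0I)
    fix i i' x
    assume i: "i \<in> block_indices \<epsilon> d" "i' \<in> block_indices \<epsilon> d" "i \<noteq> i'"
      and x: "x \<in> block G \<epsilon> d \<gamma> i \<inter> block G \<epsilon> d \<gamma> i'"
    have "i = i'"
    proof (rule PiE_ext[OF i(1,2)[unfolded block_indices_def]])
      fix j assume j: "j \<in> {1..d}"
      then have "i j \<in> {1..K}" "i' j \<in> {1..K}"
        using i(1,2) unfolding block_indices_def K_def by (metis PiE_mem)+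
      moreover have "\<gamma> j x \<in> circle_arc K (i j)" "\<gamma> j x \<in> circle_arc K (i' j)"
        using x j unfolding block_def K_def by blast+
      ultimately show "i j = i' j" by (intro circle_arc_disjoint)
    qed
    then show False using i(3) by simp
  qed
  have "x \<in> (\<Union>i\<in>block_indices \<epsilon> d. block G \<epsilon> d \<gamma> i)" if x: "x \<in> carrier G" for x
  proof
    show "restrict (\<lambda>j. arc_index K (\<gamma> j x)) {1..d} \<in> block_indices \<epsilon> d"
      unfolding block_indices_def
      using arc_index(1)[OF norm, of _ x K] x assms(2) by (auto simp: K_def simp del: atLeastAtMost_iff)
    show "x \<in> block G \<epsilon> d \<gamma> (restrict (\<lambda>j. arc_index K (\<gamma> j x)) {1..d})"
      using arc_index(2)[OF norm, of _ x K] x assms(2) by (simp add: block_def K_def)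
  qed
  then show "(\<Union>i\<in>block_indices \<epsilon> d. block G \<epsilon> d \<gamma> i) = carrier G"
    by (auto simp: block_def)
qed

text \<open>Turns an approximation on a large set \<open>A\<close> into the decomposition: the
  rounded approximation is \<open>g\<close>, its error on \<open>A\<close> is \<open>h\<close>, and
  \<open>k\<close> absorbs everything outside \<open>A\<close>. The grid vector \<open>s\<close> is
  the shift needed when \<open>\<xi>\<close> is close to 1.\<close>

lemma decomposition_of_approximation:
  fixes \<theta> :: "nat \<Rightarrow> complex" and s :: "int \<times> int"
  assumes \<delta>: "0 < \<delta>" "\<delta> \<le> \<omega>" and d: "d > 0"
    and \<gamma>: "\<And>j. j \<in> {1..d} \<Longrightarrow> \<gamma> j \<in> characters G"
    and \<theta>: "\<And>j. j \<in> {1..d} \<Longrightarrow> cmod (\<theta> j) \<le> 1"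
    and A: "A \<subseteq> carrier G" "(1 - \<xi>) * real (card (carrier G)) \<le> real (card A)"
    and approx: "\<And>x. x \<in> A \<Longrightarrow>
      cmod (f x - of_real \<omega> * ((\<Sum>j=1..d. \<theta> j * \<gamma> j x) / of_nat d)
        - of_real \<delta> * (of_int (fst s) + \<i> * of_int (snd s))) \<le> 2 * \<delta>"
    and \<epsilon>: "\<epsilon> = \<delta> / \<omega>"
  shows "\<exists>g h k.
        (\<forall>x\<in>carrier G. f x = g x + h x + k x) \<and>
        (\<forall>x\<in>carrier G. cmod (h x) \<le> 11 * \<delta>) \<and>
        real (card {x \<in> carrier G. k x \<noteq> 0}) \<le> \<xi> * real (card (carrier G)) \<and>
        disjoint_family_on (block G \<epsilon> d \<gamma>) (block_indices \<epsilon> d) \<and>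
        (\<Union>i\<in>block_indices \<epsilon> d. block G \<epsilon> d \<gamma> i) = carrier G \<and>
        (\<forall>i\<in>block_indices \<epsilon> d. \<exists>a b :: int.
           (f ` carrier G \<subseteq> \<real> \<longrightarrow> b = 0) \<and>
           (\<forall>x\<in>block G \<epsilon> d \<gamma> i. g x = of_real \<delta> * (of_int a + \<i> * of_int b)))"
proof -
  define K where "K = num_arcs \<epsilon>"
  have \<epsilon>0: "\<epsilon> > 0" using \<delta> by (simp add: \<epsilon>)
  have Kge: "1 / \<epsilon> \<le> real K" unfolding K_def num_arcs_def by linarith
  moreover have "1 / \<epsilon> > 0" using \<epsilon>0 by simp
  ultimately have K: "K > 0" by (metis of_nat_0_less_iff less_le_trans)
  have invK: "1 / real K \<le> \<epsilon>" using Kge K \<epsilon>0 by (simp add: field_simps)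
  have norm: "cmod (\<gamma> j x) = 1" if "j \<in> {1..d}" "x \<in> carrier G" for j x
    using \<gamma>[OF that(1)] that(2) by (simp add: mem_characters)
  \<comment> \<open>Characters are replaced by starting points of arcs, so \<open>W\<close> depends
    on the block index alone.\<close>
  define W where "W i = of_real \<omega> * ((\<Sum>j=1..d. \<theta> j * arc_start K (i j)) / of_nat d)
      + of_real \<delta> * (of_int (fst s) + \<i> * of_int (snd s))" for i
  define w where "w x = W (\<lambda>j. arc_index K (\<gamma> j x))" for x
  define a where "a z = round (Re z / \<delta>)" for z
  \<comment> \<open>For real-valued \<open>f\<close> the imaginary part is discarded, which cannot
    increase the distance to \<open>f x\<close>.\<close>
  define b where "b z = (if f ` carrier G \<subseteq> \<real> then 0 else round (Im z / \<delta>))" for z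
  define g where "g x = of_real \<delta> * (of_int (a (w x)) + \<i> * of_int (b (w x)))" for x
  define h where "h x = (if x \<in> A then f x - g x else 0)" for x
  define k where "k x = (if x \<in> A then 0 else f x - g x)" for x
  have err: "cmod (f x - w x) \<le> 2 * \<delta> + 2 * pi * \<delta>" if x: "x \<in> A" for x
  proof -
    have xG: "x \<in> carrier G" using x A by auto
    let ?D = "of_real \<omega> * ((\<Sum>j=1..d. \<theta> j * (\<gamma> j x - arc_start K (arc_index K (\<gamma> j x)))) / of_nat d)"
    have "cmod (\<Sum>j=1..d. \<theta> j * (\<gamma> j x - arc_start K (arc_index K (\<gamma> j x)))) \<le> (\<Sum>j=1..d. 2 * pi / real K)"
    proof (rule sum_norm_le)
      fix j assume j: "j \<in> {1..d}"
      have "cmod (\<gamma> j x - arc_start K (arc_index K (\<gamma> j x))) \<le> 2 * pi / real K"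
        by (intro dist_arc_start arc_index(2) norm j xG K)
      then have "cmod (\<theta> j) * cmod (\<gamma> j x - arc_start K (arc_index K (\<gamma> j x))) \<le> 1 * (2 * pi / real K)"
        using \<theta>[OF j] by (intro mult_mono) auto
      then show "cmod (\<theta> j * (\<gamma> j x - arc_start K (arc_index K (\<gamma> j x)))) \<le> 2 * pi / real K"
        by (simp add: norm_mult)
    qed
    then have "cmod (\<Sum>j=1..d. \<theta> j * (\<gamma> j x - arc_start K (arc_index K (\<gamma> j x)))) / real d \<le> 2 * pi * (1 / real K)"
      using d by (simp add: field_simps)
    \<comment> \<open>Since \<open>\<epsilon> = \<delta> / \<omega>\<close>, multiplying by
      \<open>\<omega>\<close> turns this discretisation error into
      \<open>2 * pi * \<delta>\<close>.\<close>
    also have "\<dots> \<le> 2 * pi * \<epsilon>" using invK by (intro mult_left_mono) auto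
    finally have "\<omega> * (cmod (\<Sum>j=1..d. \<theta> j * (\<gamma> j x - arc_start K (arc_index K (\<gamma> j x)))) / real d) \<le> \<omega> * (2 * pi * \<epsilon>)"
      using \<delta> by (intro mult_left_mono) auto
    then have D: "cmod ?D \<le> 2 * pi * \<delta>"
      using \<delta> by (simp add: norm_mult norm_divide \<epsilon>)
    have "f x - w x = (f x - of_real \<omega> * ((\<Sum>j=1..d. \<theta> j * \<gamma> j x) / of_nat d)
        - of_real \<delta> * (of_int (fst s) + \<i> * of_int (snd s))) + ?D"
      unfolding w_def W_def right_diff_distrib sum_subtractf diff_divide_distrib by simp
    then show ?thesis using norm_triangle_le[OF add_mono[OF approx[OF x] D]] by metis
  qed
  have h: "cmod (f x - g x) \<le> 11 * \<delta>" if x: "x \<in> A" for x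
  proof -
    let ?r = "of_real \<delta> * (of_int (round (Re (w x) / \<delta>)) + \<i> * of_int (round (Im (w x) / \<delta>)))"
    have r: "cmod (f x - ?r) \<le> 11 * \<delta>"
    proof -
      have "cmod (f x - ?r) \<le> cmod (f x - w x) + cmod (w x - ?r)"
        by (rule norm_diff_triangle_ineq[of "f x" "w x" "w x" ?r, simplified])
      also have "\<dots> \<le> 2 * \<delta> + 2 * pi * \<delta> + \<delta>"
        by (intro add_mono err x cmod_diff_round_le \<delta>)
      also have "\<dots> = (3 + 2 * pi) * \<delta>" by (simp add: algebra_simps)
      also have "\<dots> \<le> 11 * \<delta>" using \<delta> pi_less_4 by (intro mult_right_mono) auto
      finally show ?thesis .
    qed
    show ?thesis
    proof (cases "f ` carrier G \<subseteq> \<real>")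
      case True
      then have "f x \<in> \<real>" using x A by auto
      then have "f x - g x = of_real (Re (f x - ?r))"
        using True by (auto simp: complex_eq_iff complex_is_Real_iff g_def a_def b_def)
      then have "cmod (f x - g x) = \<bar>Re (f x - ?r)\<bar>" by (metis norm_of_real)
      also have "\<dots> \<le> cmod (f x - ?r)" by (rule abs_Re_le_cmod)
      finally show ?thesis using r by simp
    next
      case False
      then have "g x = ?r" by (simp add: g_def a_def b_def)
      then show ?thesis using r by simp
    qed
  qed
  have "{x \<in> carrier G. k x \<noteq> 0} \<subseteq> carrier G - A" by (auto simp: k_def)
  then have "card {x \<in> carrier G. k x \<noteq> 0} \<le> card (carrier G - A)"
    using fin by (intro card_mono) auto
  also have "\<dots> = card (carrier G) - card A" using A fin finite_subset by (intro card_Diff_subset) auto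
  finally have "card {x \<in> carrier G. k x \<noteq> 0} + card A \<le> card (carrier G)"
    using card_mono[OF fin A(1)] by linarith
  then have supp: "real (card {x \<in> carrier G. k x \<noteq> 0}) \<le> \<xi> * real (card (carrier G))"
    using A(2) by (simp add: algebra_simps)
  have const: "\<exists>a b :: int. (f ` carrier G \<subseteq> \<real> \<longrightarrow> b = 0) \<and>
        (\<forall>x\<in>block G \<epsilon> d \<gamma> i. g x = of_real \<delta> * (of_int a + \<i> * of_int b))"
    if i: "i \<in> block_indices \<epsilon> d" for i
  proof (intro exI conjI)
    show "f ` carrier G \<subseteq> \<real> \<longrightarrow> b (W i) = 0" by (simp add: b_def)
    show "\<forall>x\<in>block G \<epsilon> d \<gamma> i. g x = of_real \<delta> * (of_int (a (W i)) + \<i> * of_int (b (W i)))"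
    proof
      fix x assume x: "x \<in> block G \<epsilon> d \<gamma> i"
      have "arc_index K (\<gamma> j x) = i j" if j: "j \<in> {1..d}" for j
      proof (rule arc_index_eqI)
        show "cmod (\<gamma> j x) = 1" using norm[OF j] x by (simp add: block_def)
        show "i j \<in> {1..K}" using i j unfolding block_indices_def K_def by (metis PiE_mem)
        show "\<gamma> j x \<in> circle_arc K (i j)" using x j unfolding block_def K_def by blast
      qed
      then have "w x = W i" by (simp add: w_def W_def)
      then show "g x = of_real \<delta> * (of_int (a (W i)) + \<i> * of_int (b (W i)))" by (simp add: g_def)
    qed
  qed
  show ?thesis
  proof (rule exI[of _ g], rule exI[of _ h], rule exI[of _ k], intro conjI)
    show "\<forall>x\<in>carrier G. f x = g x + h x + k x" by (simp add: h_def k_def)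
    show "\<forall>x\<in>carrier G. cmod (h x) \<le> 11 * \<delta>" using h \<delta> by (simp add: h_def)
    show "disjoint_family_on (block G \<epsilon> d \<gamma>) (block_indices \<epsilon> d)"
      "(\<Union>i\<in>block_indices \<epsilon> d. block G \<epsilon> d \<gamma> i) = carrier G"
      using blocks_partition[of d \<gamma> \<epsilon>] \<gamma> K by (auto simp: K_def)
  qed (use supp const in blast)+
qed

end

section \<open>Approximation by few characters\<close>

context finite_comm_group
begin

text \<open>By \<open>fourier_inversion\<close>, \<open>f / \<omega>\<close> is the mean of
  \<open>v\<close> under the law \<open>p\<close>; the phases of the sampled coefficients become
  \<open>\<theta>\<close>. A vanishing coefficient has \<open>sgn\<close> equal to 0, so
  \<open>\<theta>\<close> is bounded by 1 rather than unimodular.\<close>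

lemma sampling_characters:
  assumes \<omega>: "wiener_norm G f = \<omega>" "\<omega> > 0" and d: "d > 0" and \<tau>: "\<tau> > 0"
  shows "\<exists>\<gamma> \<theta>. (\<forall>j\<in>{1..d}. \<gamma> j \<in> characters G \<and> cmod (\<theta> j) \<le> 1) \<and>
    real (card {x\<in>carrier G. cmod (f x - of_real \<omega> * ((\<Sum>j=1..d. \<theta> j * \<gamma> j x) / of_nat d)) > 2 * \<tau> * \<omega>})
      \<le> 4 * exp (- (real d * \<tau>\<^sup>2 / 16)) * real (card (carrier G))"
proof -
  define p where "p \<chi> = cmod (fourier_coeff G f \<chi>) / (order G * \<omega>)" for \<chi>
  define v where "v \<chi> x = sgn (fourier_coeff G f \<chi>) * \<chi> x" for \<chi> x
  have "sum p (characters G) = 1"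
    using \<omega> order_pos by (simp add: p_def sum_divide_distrib[symmetric] wiener_norm_def order_def[symmetric] field_simps)
  moreover have "f x / of_real \<omega> = (\<Sum>\<chi>\<in>characters G. of_real (p \<chi>) * v \<chi> x)" if x: "x \<in> carrier G" for x
  proof -
    have "of_real (p \<chi>) * v \<chi> x = fourier_coeff G f \<chi> * \<chi> x / of_nat (order G) / of_real \<omega>" for \<chi>
    proof -
      have "of_real (cmod c) * sgn c = c" for c :: complex by (simp add: sgn_eq)
      then have "of_real (cmod (fourier_coeff G f \<chi>)) * sgn (fourier_coeff G f \<chi>) = fourier_coeff G f \<chi>" .
      then show ?thesis unfolding p_def v_def by (simp add: divide_simps mult_ac)
    qed
    then show ?thesis
      using fourier_inversion[OF x, of f] by (simp add: sum_divide_distrib)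
  qed
  moreover have "cmod (v \<chi> x) \<le> 1" if "\<chi> \<in> characters G" "x \<in> carrier G" for \<chi> x
    using that by (simp add: v_def norm_mult norm_sgn mem_characters)
  moreover have "p \<chi> \<ge> 0" for \<chi> using \<omega> by (simp add: p_def)
  ultimately obtain t where t: "t \<in> {1..d} \<rightarrow> characters G"
    and *: "real (card {x\<in>carrier G. cmod ((\<Sum>j=1..d. v (t j) x) / of_nat d - f x / of_real \<omega>) > 2 * \<tau>})
     \<le> 4 * exp (- (real d * \<tau>\<^sup>2 / 16)) * real (card (carrier G))"
    using sampling[OF finite_characters fin, of p v "\<lambda>x. f x / of_real \<omega>" d \<tau>] d \<tau> by blast
  have "cmod (f x - of_real \<omega> * ((\<Sum>j=1..d. v (t j) x) / of_nat d)) > 2 * \<tau> * \<omega> \<longleftrightarrow>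
    cmod ((\<Sum>j=1..d. v (t j) x) / of_nat d - f x / of_real \<omega>) > 2 * \<tau>" for x
  proof -
    have "f x - of_real \<omega> * ((\<Sum>j=1..d. v (t j) x) / of_nat d)
        = of_real (- \<omega>) * ((\<Sum>j=1..d. v (t j) x) / of_nat d - f x / of_real \<omega>)"
      using \<omega> by (simp add: algebra_simps)
    then have "cmod (f x - of_real \<omega> * ((\<Sum>j=1..d. v (t j) x) / of_nat d))
        = \<omega> * cmod ((\<Sum>j=1..d. v (t j) x) / of_nat d - f x / of_real \<omega>)"
      using \<omega> by (simp only: norm_mult norm_of_real abs_minus_cancel abs_of_pos)
    then show ?thesis using \<omega> by (simp add: mult.commute)
  qed
  then show ?thesis
    using * t
    by (intro exI[of _ t] exI[of _ "\<lambda>j. sgn (fourier_coeff G f (t j))"])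
      (auto simp: v_def norm_sgn simp del: One_nat_def)
qed

text \<open>For \<open>\<xi>\<close> bounded away from 1 plain sampling suffices, with
  \<open>s\<close> zero; for \<open>\<xi>\<close> near 1 too few samples are available, and the
  pigeonhole principle supplies \<open>s\<close>. The factor 2 before \<open>real d\<close> leaves
  room for rounding \<open>d\<close> to an integer.\<close>

lemma approximation_by_characters:
  assumes \<omega>: "wiener_norm G f = \<omega>" and \<xi>: "0 < \<xi>" "\<xi> < 1" and \<delta>: "0 < \<delta>" "\<delta> \<le> \<omega>"
    and d: "d > 0" "30000 * (\<omega>\<^sup>2 / \<delta>\<^sup>2) * ln (1 / \<xi>) \<le> 2 * real d"
  shows "\<exists>\<gamma> \<theta> (s :: int \<times> int) A.
    (\<forall>j\<in>{1..d}. \<gamma> j \<in> characters G \<and> cmod (\<theta> j) \<le> 1) \<and>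
    A \<subseteq> carrier G \<and> (1 - \<xi>) * real (card (carrier G)) \<le> real (card A) \<and>
    (\<forall>x\<in>A. cmod (f x - of_real \<omega> * ((\<Sum>j=1..d. \<theta> j * \<gamma> j x) / of_nat d)
        - of_real \<delta> * (of_int (fst s) + \<i> * of_int (snd s))) \<le> 2 * \<delta>)"
proof -
  define t where "t = ln (1 / \<xi>)"
  define N where "N = real (card (carrier G))"
  have t: "t > 0" using \<xi> by (simp add: t_def)
  have \<xi>t: "\<xi> = exp (- t)" using \<xi> by (simp add: t_def ln_div)
  have \<omega>0: "\<omega> > 0" using \<delta> by linarith
  have dt: "15000 * (\<omega> / \<delta>)\<^sup>2 * t \<le> real d" using d(2) by (simp add: t_def power_divide)
  have exp1: "exp 1 \<ge> (2::real)" using exp_ge_add_one_self[of "1::real"] by simp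
  define e where "e \<gamma> \<theta> x = f x - of_real \<omega> * ((\<Sum>j=1..d. \<theta> j * \<gamma> j x) / of_nat d)"
    for \<gamma> :: "nat \<Rightarrow> 'a \<Rightarrow> complex" and \<theta> :: "nat \<Rightarrow> complex" and x
  have sample: "\<exists>\<gamma> \<theta>. (\<forall>j\<in>{1..d}. \<gamma> j \<in> characters G \<and> cmod (\<theta> j) \<le> 1) \<and>
      (1 - 4 * exp (- (real d * \<tau>\<^sup>2 / 16))) * N \<le> real (card {x\<in>carrier G. cmod (e \<gamma> \<theta> x) \<le> 2 * \<tau> * \<omega>})"
    if \<tau>: "\<tau> > 0" for \<tau>
  proof -
    obtain \<gamma> \<theta> where \<gamma>\<theta>: "\<forall>j\<in>{1..d}. \<gamma> j \<in> characters G \<and> cmod (\<theta> j) \<le> 1"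
      and bad: "real (card {x\<in>carrier G. cmod (e \<gamma> \<theta> x) > 2 * \<tau> * \<omega>}) \<le> 4 * exp (- (real d * \<tau>\<^sup>2 / 16)) * N"
      using sampling_characters[OF \<omega> \<omega>0 d(1) \<tau>] unfolding e_def N_def by blast
    define P where "P = {x\<in>carrier G. cmod (e \<gamma> \<theta> x) \<le> 2 * \<tau> * \<omega>}"
    define Q where "Q = {x\<in>carrier G. cmod (e \<gamma> \<theta> x) > 2 * \<tau> * \<omega>}"
    have "carrier G = P \<union> Q" by (auto simp: P_def Q_def)
    then have "card (carrier G) \<le> card P + card Q" by (simp add: card_Un_le)
    then have "N \<le> real (card P) + real (card Q)"
      unfolding N_def by (simp only: of_nat_add[symmetric] of_nat_le_iff)
    then have "(1 - 4 * exp (- (real d * \<tau>\<^sup>2 / 16))) * N \<le> real (card P)"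
      using bad[folded Q_def] by (simp add: algebra_simps)
    then show ?thesis using \<gamma>\<theta> unfolding P_def by blast
  qed
  show ?thesis
  \<comment> \<open>The threshold satisfies both cases: the first uses
    \<open>2 + t \<le> 15000 * t / 16\<close>, the second that \<open>16 * t\<close> is well below
    1.\<close>
  proof (cases "t \<ge> 1 / 72")
    case True
    have "15000 * t \<le> real d * (\<delta> / \<omega>)\<^sup>2"
      using dt \<omega>0 \<delta> by (simp add: field_simps)
    \<comment> \<open>The spare \<open>exp (- 2)\<close> absorbs the factor 4.\<close>
    then have "4 * exp (- (real d * (\<delta> / \<omega>)\<^sup>2 / 16)) \<le> 4 * exp (- 2 - t)"
      using True by simp
    also have "\<dots> \<le> exp 2 * exp (- 2 - t)"
    proof -
      have "4 \<le> exp 1 * exp (1::real)" using mult_mono[OF exp1 exp1] by simp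
      then have "4 \<le> exp (2::real)" by (simp add: exp_add[symmetric])
      then show ?thesis by (intro mult_right_mono) auto
    qed
    also have "\<dots> = \<xi>" by (simp add: exp_add[symmetric] \<xi>t)
    finally have "(1 - \<xi>) * N \<le> (1 - 4 * exp (- (real d * (\<delta> / \<omega>)\<^sup>2 / 16))) * N"
      by (intro mult_right_mono) (auto simp: N_def)
    moreover obtain \<gamma> \<theta> where \<gamma>\<theta>: "\<forall>j\<in>{1..d}. \<gamma> j \<in> characters G \<and> cmod (\<theta> j) \<le> 1"
      and good: "(1 - 4 * exp (- (real d * (\<delta> / \<omega>)\<^sup>2 / 16))) * N
        \<le> real (card {x\<in>carrier G. cmod (e \<gamma> \<theta> x) \<le> 2 * (\<delta> / \<omega>) * \<omega>})"
      using sample[of "\<delta> / \<omega>"] \<delta> \<omega>0 by auto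
    ultimately show ?thesis
      using \<omega>0
      by (intro exI[of _ \<gamma>] exI[of _ \<theta>] exI[of _ "(0, 0)"] exI[of _ "{x\<in>carrier G. cmod (e \<gamma> \<theta> x) \<le> 2 * \<delta>}"])
        (auto simp: e_def N_def)
  next
    case False
    \<comment> \<open>Chosen so that the exponent \<open>real d * \<tau>\<^sup>2 / 16\<close> is 3
      and the bad points make up at most half of \<open>G\<close>.\<close>
    define \<tau> where "\<tau> = sqrt (48 / real d)"
    have \<tau>: "\<tau> > 0" "\<tau>\<^sup>2 = 48 / real d" using d by (auto simp: \<tau>_def)
    obtain \<gamma> \<theta> where \<gamma>\<theta>: "\<forall>j\<in>{1..d}. \<gamma> j \<in> characters G \<and> cmod (\<theta> j) \<le> 1"
      and good: "(1 - 4 * exp (- (real d * \<tau>\<^sup>2 / 16))) * N \<le> real (card {x\<in>carrier G. cmod (e \<gamma> \<theta> x) \<le> 2 * \<tau> * \<omega>})"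
      using sample[OF \<tau>(1)] by auto
    define A0 where "A0 = {x\<in>carrier G. cmod (e \<gamma> \<theta> x) \<le> 2 * \<tau> * \<omega>}"
    have "8 \<le> exp (3::real)"
    proof -
      have "(2::real) ^ 3 \<le> exp 1 ^ 3" using exp1 by (intro power_mono) auto
      then show ?thesis by (simp add: exp_of_nat_mult[symmetric])
    qed
    then have "4 * exp (- 3) \<le> (1 / 2 :: real)" by (simp add: exp_minus field_simps)
    then have "(1 / 2) * N \<le> (1 - 4 * exp (- (real d * \<tau>\<^sup>2 / 16))) * N"
      using d by (intro mult_right_mono) (auto simp: \<tau> N_def)
    then have half: "N / 2 \<le> real (card A0)" using good by (simp add: A0_def)
    \<comment> \<open>The radius of the disc containing the errors on \<open>A0\<close>, in units of
      \<open>\<delta>\<close>; \<open>M\<close> then bounds the rounded coordinates.\<close>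
    define r where "r = 2 * \<tau> * \<omega> / \<delta>"
    define M where "M = \<lfloor>r + 1 / 2\<rfloor>"
    have r0: "r \<ge> 0" using \<tau> \<omega>0 \<delta> by (simp add: r_def)
    have M: "M \<ge> 0" "real_of_int M \<le> r + 1 / 2" using r0 unfolding M_def by linarith+
    define Box where "Box = {- M..M} \<times> {- M..M}"
    \<comment> \<open>The fibres of \<open>\<phi>\<close> group the points by the grid square of
      side \<open>\<delta>\<close> that contains their error.\<close>
    define \<phi> where "\<phi> x = (round (Re (e \<gamma> \<theta> x) / \<delta>), round (Im (e \<gamma> \<theta> x) / \<delta>))" for x
    have bound: "round u \<in> {- M..M}" if "\<bar>u\<bar> \<le> r" for u
    proof -
      have "round u \<le> M" unfolding M_def round_def using that by (intro floor_mono) linarith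
      moreover have "- round u \<le> M"
      proof -
        have "real_of_int (- round u) \<le> r + 1 / 2" using of_int_round_ge[of u] that by simp
        then show ?thesis unfolding M_def by (simp only: le_floor_iff)
      qed
      ultimately show ?thesis by simp
    qed
    have \<phi>: "\<phi> \<in> A0 \<rightarrow> Box"
    proof
      fix x assume "x \<in> A0"
      then have "cmod (e \<gamma> \<theta> x) / \<delta> \<le> r"
        using \<delta> by (simp add: A0_def r_def divide_right_mono)
      moreover have "\<bar>Re (e \<gamma> \<theta> x) / \<delta>\<bar> \<le> cmod (e \<gamma> \<theta> x) / \<delta>" "\<bar>Im (e \<gamma> \<theta> x) / \<delta>\<bar> \<le> cmod (e \<gamma> \<theta> x) / \<delta>"
        using \<delta> abs_Re_le_cmod abs_Im_le_cmod by (auto simp: divide_right_mono)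
      ultimately show "\<phi> x \<in> Box" unfolding \<phi>_def Box_def using bound by auto
    qed
    have "finite A0" using fin by (simp add: A0_def)
    moreover have "finite Box" "Box \<noteq> {}" using M by (auto simp: Box_def)
    ultimately obtain s where s: "card A0 \<le> card (\<phi> -` {s} \<inter> A0) * card Box"
      using pigeonhole_card[OF \<phi>] by blast
    define A where "A = \<phi> -` {s} \<inter> A0"
    have "real (card Box) = (2 * real_of_int M + 1)\<^sup>2"
      using M by (simp add: Box_def card_cartesian_product power2_eq_square)
    also have "\<dots> \<le> (2 * r + 2)\<^sup>2" using M by (intro power_mono) auto
    \<comment> \<open>The difference of the two sides is \<open>4 * (r - 1)\<^sup>2\<close>.\<close>
    also have "\<dots> \<le> 8 * r\<^sup>2 + 8"
      using zero_le_power2[of "r - 1"] by (simp add: power2_eq_square algebra_simps)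
    also have "\<dots> \<le> 1 / (2 * t)"
    proof -
      have "r\<^sup>2 = 192 * ((\<omega> / \<delta>)\<^sup>2 / real d)"
        by (simp add: r_def power_mult_distrib power_divide \<tau>)
      then have "15000 * (r\<^sup>2 * t) = 192 * ((15000 * (\<omega> / \<delta>)\<^sup>2 * t) / real d)" by simp
      also have "(15000 * (\<omega> / \<delta>)\<^sup>2 * t) / real d \<le> 1"
        using dt d(1) by (subst pos_divide_le_eq) simp_all
      finally have "(8 * r\<^sup>2 + 8) * (2 * t) \<le> 1" using False by (simp add: algebra_simps)
      then show ?thesis using t by (simp add: pos_le_divide_eq)
    qed
    finally have Box: "real (card Box) \<le> 1 / (2 * t)" .
    have "N / 2 \<le> real (card A) * real (card Box)"
      using half s unfolding A_def by (metis of_nat_le_iff of_nat_mult order_trans)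
    also have "\<dots> \<le> real (card A) * (1 / (2 * t))" using Box by (intro mult_left_mono) auto
    finally have "t * N \<le> real (card A)" using t by (simp add: field_simps)
    \<comment> \<open>As \<open>\<xi> = exp (- t)\<close>, density \<open>t\<close> is at least the
      density \<open>1 - \<xi>\<close> required.\<close>
    moreover have "(1 - \<xi>) * N \<le> t * N"
      using exp_ge_add_one_self[of "- t"] by (intro mult_right_mono) (auto simp: \<xi>t N_def)
    ultimately have card: "(1 - \<xi>) * N \<le> real (card A)" by linarith
    have "cmod (e \<gamma> \<theta> x - of_real \<delta> * (of_int (fst s) + \<i> * of_int (snd s))) \<le> 2 * \<delta>" if "x \<in> A" for x
    proof -
      have "s = \<phi> x" using that by (simp add: A_def)
      then show ?thesis using cmod_diff_round_le[OF \<delta>(1), of "e \<gamma> \<theta> x"] \<delta> by (simp add: \<phi>_def)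
    qed
    then show ?thesis
      using \<gamma>\<theta> card
      by (intro exI[of _ \<gamma>] exI[of _ \<theta>] exI[of _ s] exI[of _ A]) (auto simp: e_def N_def A_def A0_def)
  qed
qed

end

theorem theorem4:
  "\<exists>c\<^sub>1 c\<^sub>2 c\<^sub>3 :: real. c\<^sub>1 > 0 \<and> c\<^sub>2 > 0 \<and> c\<^sub>3 > 0 \<and>
    (\<forall>(G :: 'a monoid) (f :: 'a \<Rightarrow> complex) (\<omega> :: real) (\<xi> :: real) (\<delta> :: real).
      comm_group G \<and> finite (carrier G) \<and> wiener_norm G f = \<omega> \<and>
      0 < \<xi> \<and> \<xi> < 1 \<and> 0 < \<delta> \<and> \<delta> \<le> \<omega> \<longrightarrow>
      (\<exists>(\<epsilon> :: real) (d :: nat) (\<gamma> :: nat \<Rightarrow> 'a \<Rightarrow> complex)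
         (g :: 'a \<Rightarrow> complex) (h :: 'a \<Rightarrow> complex) (k :: 'a \<Rightarrow> complex).
        0 < \<epsilon> \<and> \<epsilon> \<le> 1 \<and> 0 < d \<and>
        (\<forall>j\<in>{1..d}. \<gamma> j \<in> hom G circle_group) \<and>
        (\<forall>x\<in>carrier G. f x = g x + h x + k x) \<and>
        (\<forall>x\<in>carrier G. cmod (h x) \<le> c\<^sub>1 * \<delta>) \<and>
        real (card {x \<in> carrier G. k x \<noteq> 0}) \<le> \<xi> * real (card (carrier G)) \<and>
        disjoint_family_on (block G \<epsilon> d \<gamma>) (block_indices \<epsilon> d) \<and>
        (\<Union>i\<in>block_indices \<epsilon> d. block G \<epsilon> d \<gamma> i) = carrier G \<and>
        (\<forall>i\<in>block_indices \<epsilon> d. \<exists>a b :: int.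
           (f ` carrier G \<subseteq> \<real> \<longrightarrow> b = 0) \<and>
           (\<forall>x\<in>block G \<epsilon> d \<gamma> i. g x = of_real \<delta> * (of_int a + \<i> * of_int b))) \<and>
        \<epsilon> \<ge> c\<^sub>2 * (\<delta> / \<omega>) \<and>
        real d \<le> max 1 (c\<^sub>3 * (\<omega>\<^sup>2 / \<delta>\<^sup>2) * ln (1 / \<xi>))))"
\<comment> \<open>The 11 bounds \<open>3 + 2 * pi\<close>, the 1 reflects
  \<open>\<epsilon> = \<delta> / \<omega>\<close>, and 30000 is twice the sampling constant
  15000.\<close>
proof (rule exI[of _ 11], rule exI[of _ 1], rule exI[of _ 30000], intro conjI allI impI)
  show "(11::real) > 0" "(1::real) > 0" "(30000::real) > 0" by auto
next
  fix G :: "'a monoid" and f :: "'a \<Rightarrow> complex" and \<omega> \<xi> \<delta> :: real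
  assume asm: "comm_group G \<and> finite (carrier G) \<and> wiener_norm G f = \<omega> \<and>
      0 < \<xi> \<and> \<xi> < 1 \<and> 0 < \<delta> \<and> \<delta> \<le> \<omega>"
  then interpret finite_comm_group G
    by (simp add: finite_comm_group_def finite_comm_group_axioms_def)
  define L where "L = 30000 * (\<omega>\<^sup>2 / \<delta>\<^sup>2) * ln (1 / \<xi>)"
  \<comment> \<open>Rounding down keeps \<open>d\<close> below the bound;
    \<open>L \<le> 2 * real d\<close> still holds because \<open>d\<close> is at least 1.\<close>
  define d where "d = max 1 (nat \<lfloor>L\<rfloor>)"
  define \<epsilon> where "\<epsilon> = \<delta> / \<omega>"
  have L: "L \<ge> 0" using asm by (simp add: L_def)
  have d: "d > 0" "real d \<le> max 1 L" "L \<le> 2 * real d"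
    using L unfolding d_def by linarith+
  obtain \<gamma> \<theta> A and s :: "int \<times> int" where
    \<gamma>\<theta>: "\<forall>j\<in>{1..d}. \<gamma> j \<in> characters G \<and> cmod (\<theta> j) \<le> 1"
    and A: "A \<subseteq> carrier G" "(1 - \<xi>) * real (card (carrier G)) \<le> real (card A)"
    and approx: "\<forall>x\<in>A. cmod (f x - of_real \<omega> * ((\<Sum>j=1..d. \<theta> j * \<gamma> j x) / of_nat d)
        - of_real \<delta> * (of_int (fst s) + \<i> * of_int (snd s))) \<le> 2 * \<delta>"
    using approximation_by_characters[of f \<omega> \<xi> \<delta> d] asm d unfolding L_def by blast
  obtain g h k where "(\<forall>x\<in>carrier G. f x = g x + h x + k x) \<and>
        (\<forall>x\<in>carrier G. cmod (h x) \<le> 11 * \<delta>) \<and>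
        real (card {x \<in> carrier G. k x \<noteq> 0}) \<le> \<xi> * real (card (carrier G)) \<and>
        disjoint_family_on (block G \<epsilon> d \<gamma>) (block_indices \<epsilon> d) \<and>
        (\<Union>i\<in>block_indices \<epsilon> d. block G \<epsilon> d \<gamma> i) = carrier G \<and>
        (\<forall>i\<in>block_indices \<epsilon> d. \<exists>a b :: int.
           (f ` carrier G \<subseteq> \<real> \<longrightarrow> b = 0) \<and>
           (\<forall>x\<in>block G \<epsilon> d \<gamma> i. g x = of_real \<delta> * (of_int a + \<i> * of_int b)))"
    using decomposition_of_approximation[of \<delta> \<omega> d \<gamma> \<theta> A \<xi> f s \<epsilon>] asm d(1) \<gamma>\<theta> A approx \<epsilon>_def by blast
  moreover have "0 < \<epsilon>" "\<epsilon> \<le> 1" "\<epsilon> \<ge> 1 * (\<delta> / \<omega>)" using asm by (auto simp: \<epsilon>_def)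
  moreover have "\<forall>j\<in>{1..d}. \<gamma> j \<in> hom G circle_group" using \<gamma>\<theta> by (auto simp: characters_def)
  ultimately show "\<exists>(\<epsilon> :: real) (d :: nat) (\<gamma> :: nat \<Rightarrow> 'a \<Rightarrow> complex)
         (g :: 'a \<Rightarrow> complex) (h :: 'a \<Rightarrow> complex) (k :: 'a \<Rightarrow> complex).
        0 < \<epsilon> \<and> \<epsilon> \<le> 1 \<and> 0 < d \<and>
        (\<forall>j\<in>{1..d}. \<gamma> j \<in> hom G circle_group) \<and>
        (\<forall>x\<in>carrier G. f x = g x + h x + k x) \<and>
        (\<forall>x\<in>carrier G. cmod (h x) \<le> 11 * \<delta>) \<and>
        real (card {x \<in> carrier G. k x \<noteq> 0}) \<le> \<xi> * real (card (carrier G)) \<and>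
        disjoint_family_on (block G \<epsilon> d \<gamma>) (block_indices \<epsilon> d) \<and>
        (\<Union>i\<in>block_indices \<epsilon> d. block G \<epsilon> d \<gamma> i) = carrier G \<and>
        (\<forall>i\<in>block_indices \<epsilon> d. \<exists>a b :: int.
           (f ` carrier G \<subseteq> \<real> \<longrightarrow> b = 0) \<and>
           (\<forall>x\<in>block G \<epsilon> d \<gamma> i. g x = of_real \<delta> * (of_int a + \<i> * of_int b))) \<and>
        \<epsilon> \<ge> 1 * (\<delta> / \<omega>) \<and>
        real d \<le> max 1 (30000 * (\<omega>\<^sup>2 / \<delta>\<^sup>2) * ln (1 / \<xi>))"
    using d unfolding L_def by blast
qed

end
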